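(* Let $n\ge1$ be an integer and consider the line graph $L_n$ with root $n$ and payment function $p=\mathbf 1_n$. Let $i\in\{1,\dots,n-1\}$ and $\epsilon\in(0,1]$. (1) For $\lambda\in(0,\infty)\setminus\{1\}$, $$\mathrm{Stake}(\epsilon,\lambda,i)=\epsilon\cdot\left(\frac{\lambda+1}{\lambda-1}\cdot i\cdot\left(1-\frac{n(\lambda^i-1)}{i(\lambda^n-1)}\right)\right)^{-1}.$$ (2) For $\lambda\in(0,\infty)\setminus\{1\}$, $\mathrm{Stake}(\epsilon,\lambda,i)=\mathrm{Stake}(\epsilon,\lambda^{-1},n-i)$. (3) $\mathrm{Stake}(\epsilon,1,i)=\epsilon\cdot\frac1{i(n-i)}$. (4) The preceding results are equally valid when the payment function $\mathbf 1_n$ is replaced by any $p:\{0,n\}\to[0,\infty)$ for which $p(0)<p(n)$.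
   Context: $L_n$ has vertex set $\{0,1,\dots,n\}$ with edges joining consecutive integers. Its boundary is $B=\{0,n\}$ and $O=\{1,\dots,n-1\}$. For a payment function $p:\{0,n\}\to[0,\infty)$ and $\lambda\in(0,\infty)$, $h(\lambda,\cdot)$ is the unique function on $\{0,\dots,n\}$ with $h(\lambda,0)=p(0)$, $h(\lambda,n)=p(n)$ and $h(\lambda,v)=\frac{\lambda}{\lambda+1}\max_{u\sim v}h(\lambda,u)+\frac1{\lambda+1}\min_{u\sim v}h(\lambda,u)$ for $v\in O$, where $u\sim v$ denotes adjacency. For $v\in O$, $\Delta(\lambda,v)=\max_{w\sim v}h(\lambda,w)-\min_{w\sim v}h(\lambda,w)$ and $$\mathrm{Stake}(\epsilon,\lambda,v)=\frac{\epsilon\,\Delta(\lambda,v)}{(\lambda+1)^2\frac{\partial}{\partial\lambda}h(\lambda,v)}.$$ *)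

theory Defs
  imports "HOL-Analysis.Analysis"
begin

definition line_adj :: "nat \<Rightarrow> nat \<Rightarrow> nat \<Rightarrow> bool" where
  "line_adj n u v \<longleftrightarrow> u \<le> n \<and> v \<le> n \<and> (v = Suc u \<or> u = Suc v)"

definition line_nbrs :: "nat \<Rightarrow> nat \<Rightarrow> nat set" where
  "line_nbrs n v = {u. line_adj n u v}"

definition line_boundary :: "nat \<Rightarrow> nat set" where
  "line_boundary n = {0, n}"

definition line_open :: "nat \<Rightarrow> nat set" where
  "line_open n = {0..n} - line_boundary n"

text \<open>A payment function is a total function, of which only the values on
  \<^term>\<open>line_boundary n\<close> are ever used.\<close>

definition biased_infinity_harmonic ::
    "nat \<Rightarrow> (nat \<Rightarrow> real) \<Rightarrow> real \<Rightarrow> (nat \<Rightarrow> real) \<Rightarrow> bool" where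
  "biased_infinity_harmonic n p lam f \<longleftrightarrow>
     (\<forall>v\<in>line_boundary n. f v = p v) \<and>
     (\<forall>v\<in>line_open n.
        f v = lam / (lam + 1) * Max (f ` line_nbrs n v)
            + 1 / (lam + 1) * Min (f ` line_nbrs n v))"

text \<open>A function on \<open>{0..n}\<close> is represented by its extension by
  \<^term>\<open>undefined\<close>, so that uniqueness on \<open>{0..n}\<close> is uniqueness
  of the total function.\<close>

definition line_value :: "nat \<Rightarrow> (nat \<Rightarrow> real) \<Rightarrow> real \<Rightarrow> nat \<Rightarrow> real" where
  "line_value n p lam =
     (THE f. f \<in> extensional {0..n} \<and> biased_infinity_harmonic n p lam f)"

definition line_Delta :: "nat \<Rightarrow> (nat \<Rightarrow> real) \<Rightarrow> real \<Rightarrow> nat \<Rightarrow> real" where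
  "line_Delta n p lam v =
     Max (line_value n p lam ` line_nbrs n v) - Min (line_value n p lam ` line_nbrs n v)"

definition Stake :: "nat \<Rightarrow> (nat \<Rightarrow> real) \<Rightarrow> real \<Rightarrow> real \<Rightarrow> nat \<Rightarrow> real" where
  "Stake n p eps lam v =
     eps * line_Delta n p lam v /
       ((lam + 1)\<^sup>2 * deriv (\<lambda>l. line_value n p l v) lam)"

end

theory Submission
  imports Defs
begin

text \<open>
  If the payment at the right end is larger, a biased infinity harmonic function must increase
  along the whole line: its value at an interior vertex is a strict convex combination
  of the two neighbouring values, so consecutive increments have the same sign, and their sum is
  positive.  The maximum and the minimum in the defining equation are then attained at the right
  and at the left neighbour, and the equation says that the increment into \<open>v\<close> is \<open>\<lambda>\<close> times the
  increment out of \<open>v\<close>.  Increments thus form a geometric progression, and with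
  \<open>S\<^sub>k(\<lambda>) = 1 + \<lambda> + \<dots> + \<lambda>\<^bsup>k-1\<^esup>\<close> the value is
  \<open>h(\<lambda>, v) = p(n) - (p(n) - p(0)) S\<^bsub>n-v\<^esub>(\<lambda>) / S\<^sub>n(\<lambda>)\<close>
  (\<open>increasing_solution_eq_profile\<close>, \<open>line_value_eq_profile\<close>).

  Both \<open>\<Delta>\<close> and the derivative in \<open>\<lambda>\<close> are proportional to \<open>p(n) - p(0)\<close>, so the stake does not
  depend on the payments.  It equals \<open>\<epsilon> \<lambda>\<^bsup>n-i-1\<^esup> S\<^sub>n / ((\<lambda> + 1) W)\<close>, where
  \<open>W = S\<^bsub>n-i\<^esub> S\<^sub>n' - S\<^bsub>n-i\<^esub>' S\<^sub>n\<close> is a Wronskian (\<open>Stake_eq_wronskian\<close>).  Because the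
  polynomials \<open>S\<^sub>k\<close> replace the quotients \<open>(\<lambda>\<^sup>k - 1) / (\<lambda> - 1)\<close>, this remains meaningful at
  \<open>\<lambda> = 1\<close>, where it gives \<open>\<epsilon> / (i (n - i))\<close>.  For \<open>\<lambda> \<noteq> 1\<close>, differentiating
  \<open>(\<lambda> - 1) S\<^sub>k = \<lambda>\<^sup>k - 1\<close> evaluates the Wronskian (\<open>geom_wronskian\<close>), and the symmetry under
  \<open>\<lambda> \<mapsto> 1/\<lambda>\<close>, \<open>i \<mapsto> n - i\<close> can be read off from the closed formula.
\<close>

section \<open>Geometric sums\<close>

definition geom :: "nat \<Rightarrow> real \<Rightarrow> real" where
  "geom k x = (\<Sum>j<k. x ^ j)"

definition geom_deriv :: "nat \<Rightarrow> real \<Rightarrow> real" where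
  "geom_deriv k x = (\<Sum>j<k. real j * x ^ (j - 1))"

lemma geom_0 [simp]: "geom 0 x = 0"
  by (simp add: geom_def)

lemma geom_Suc: "geom (Suc k) x = geom k x + x ^ k"
  by (simp add: geom_def)

lemma geom_at_1 [simp]: "geom k 1 = real k"
  by (simp add: geom_def)

lemma geom_pos: "0 < x \<Longrightarrow> 0 < k \<Longrightarrow> 0 < geom k x"
  unfolding geom_def by (rule sum_pos) auto

lemma geom_mult_diff: "(x - 1) * geom k x = x ^ k - 1"
  by (induction k) (simp_all add: geom_Suc algebra_simps)

lemma geom_add: "geom (a + b) x = geom a x + x ^ a * geom b x"
  by (induction b) (simp_all add: geom_Suc algebra_simps power_add)

lemma geom_has_field_derivative: "(geom k has_field_derivative geom_deriv k x) (at x)"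
  unfolding geom_def [abs_def] geom_deriv_def
  by (auto intro!: derivative_eq_intros sum.cong)

lemma geom_deriv_at_1: "geom_deriv k 1 = real k * (real k - 1) / 2"
  unfolding geom_deriv_def by (induction k) (simp_all add: field_simps)

text \<open>This is the product rule applied to \<open>(x - 1) S\<^sub>k = x\<^sup>k - 1\<close>.\<close>

lemma geom_deriv_mult_diff: "(x - 1) * geom_deriv k x = real k * x ^ (k - 1) - geom k x"
proof (induction k)
  case 0
  then show ?case by (simp add: geom_deriv_def)
next
  case (Suc k)
  have "(x - 1) * geom_deriv (Suc k) x
      = (x - 1) * geom_deriv k x + (x - 1) * (real k * x ^ (k - 1))"
    by (simp add: geom_deriv_def algebra_simps)
  also have "\<dots> = real k * (x * x ^ (k - 1)) - geom k x"
    unfolding Suc.IH by (simp add: algebra_simps)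
  also have "real k * (x * x ^ (k - 1)) = real k * x ^ k"
    by (cases k) auto
  finally show ?case
    by (simp add: geom_Suc algebra_simps)
qed

text \<open>Multiplication by \<open>x - 1\<close> removes the derivatives through \<open>geom_deriv_mult_diff\<close>.  The two
  products \<open>S\<^bsub>n-i\<^esub> S\<^sub>n\<close> cancel, and \<open>x\<^sup>i S\<^bsub>n-i\<^esub> = S\<^sub>n - S\<^sub>i\<close>.\<close>

lemma geom_wronskian:
  assumes "0 < i" "i < n"
  shows "(x - 1) * (geom (n - i) x * geom_deriv n x - geom_deriv (n - i) x * geom n x)
    = x ^ (n - i - 1) * (real i * geom n x - real n * geom i x)"
proof -
  have split: "geom n x = geom i x + x ^ i * geom (n - i) x"
    using geom_add [of i "n - i" x] assms by simp
  have pow: "x ^ (n - 1) = x ^ (n - i - 1) * x ^ i"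
    using assms by (simp flip: power_add)
  have "(x - 1) * (geom (n - i) x * geom_deriv n x - geom_deriv (n - i) x * geom n x)
      = geom (n - i) x * ((x - 1) * geom_deriv n x)
        - ((x - 1) * geom_deriv (n - i) x) * geom n x"
    by (simp add: algebra_simps)
  also have "\<dots> = real n * x ^ (n - 1) * geom (n - i) x
      - real (n - i) * x ^ (n - i - 1) * geom n x"
    unfolding geom_deriv_mult_diff by (simp add: algebra_simps)
  also have "\<dots> = x ^ (n - i - 1)
      * (real n * (x ^ i * geom (n - i) x) - real (n - i) * geom n x)"
    unfolding pow by (simp add: algebra_simps)
  also have "x ^ i * geom (n - i) x = geom n x - geom i x"
    using split by simp
  also have "real n * (geom n x - geom i x) - real (n - i) * geom n x
      = real i * geom n x - real n * geom i x"
    using assms by (simp add: of_nat_diff algebra_simps)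
  finally show ?thesis .
qed

section \<open>Biased infinity harmonic functions on the line\<close>

lemma line_nbrs_interior:
  "0 < v \<Longrightarrow> v < n \<Longrightarrow> line_nbrs n v = {v - 1, Suc v}"
  by (auto simp: line_nbrs_def line_adj_def)

lemma Max_line_nbrs:
  fixes f :: "nat \<Rightarrow> real"
  shows "0 < v \<Longrightarrow> v < n \<Longrightarrow> Max (f ` line_nbrs n v) = max (f (v - 1)) (f (Suc v))"
  by (simp add: line_nbrs_interior)

lemma Min_line_nbrs:
  fixes f :: "nat \<Rightarrow> real"
  shows "0 < v \<Longrightarrow> v < n \<Longrightarrow> Min (f ` line_nbrs n v) = min (f (v - 1)) (f (Suc v))"
  by (simp add: line_nbrs_interior)

lemma biased_infinity_harmonic_iff:
  "biased_infinity_harmonic n p x f \<longleftrightarrow>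
    f 0 = p 0 \<and> f n = p n \<and>
    (\<forall>v. 0 < v \<and> v < n \<longrightarrow>
      f v = x / (x + 1) * max (f (v - 1)) (f (Suc v))
          + 1 / (x + 1) * min (f (v - 1)) (f (Suc v)))"
proof -
  have "line_open n = {v. 0 < v \<and> v < n}"
    by (auto simp: line_open_def line_boundary_def)
  then show ?thesis
    by (auto simp: biased_infinity_harmonic_def line_boundary_def Max_line_nbrs Min_line_nbrs)
qed

text \<open>This form of the harmonicity equation is linear and links only increments, provided that
  the neighbouring values \<open>a\<close> and \<open>b\<close> are known to be in order.\<close>

lemma biased_mean_increasing_iff:
  fixes x :: real
  assumes "0 < x" "a \<le> b"
  shows "c = x / (x + 1) * max a b + 1 / (x + 1) * min a b \<longleftrightarrow> c - a = x * (b - c)"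
proof -
  have "x / (x + 1) * max a b + 1 / (x + 1) * min a b = (x * b + a) / (x + 1)"
    using assms(2) by (simp add: add_divide_distrib)
  moreover have "c = (x * b + a) / (x + 1) \<longleftrightarrow> c * (x + 1) = x * b + a"
    using assms(1) by (subst eq_divide_eq) simp
  ultimately show ?thesis
    by (auto simp: algebra_simps)
qed

text \<open>The mean is strictly between \<open>a\<close> and \<open>b\<close> unless they agree, so the step to \<open>c\<close> and the
  step from \<open>c\<close> go in the same direction.\<close>

lemma biased_mean_step_sign:
  fixes x :: real
  assumes "0 < x" and c: "c = x / (x + 1) * max a b + 1 / (x + 1) * min a b"
  shows "a < c \<longleftrightarrow> c < b"
proof (cases "a \<le> b")
  case True
  then have "c - a = x * (b - c)"
    using assms biased_mean_increasing_iff by blast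
  then show ?thesis
    using assms(1) by (metis diff_gt_0_iff_gt zero_less_mult_pos mult_pos_pos)
next
  case False
  then have "c - b = x * (a - c)"
    using biased_mean_increasing_iff [OF \<open>0 < x\<close>, of b a c] c
    by (simp add: max.commute min.commute)
  moreover have "0 < x * (a - c) \<longleftrightarrow> c < a" "x * (a - c) < 0 \<longleftrightarrow> a < c"
    using \<open>0 < x\<close> by (simp_all add: zero_less_mult_iff mult_less_0_iff)
  ultimately have "b < c \<longleftrightarrow> c < a" "c < b \<longleftrightarrow> a < c"
    by linarith+
  then show ?thesis
    using False by linarith
qed

text \<open>All increments are positive or none is, by \<open>biased_mean_step_sign\<close>.  The payments rule out
  the second case.\<close>

lemma solution_strictly_increasing:
  assumes "0 < x" and f: "biased_infinity_harmonic n p x f" and "p 0 < p n" and "v < n"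
  shows "f v < f (Suc v)"
proof -
  have step: "f v < f (Suc v) \<longleftrightarrow> f 0 < f 1" if "v < n" for v
    using that
  proof (induction v)
    case (Suc v)
    then have "f (Suc v) = x / (x + 1) * max (f v) (f (Suc (Suc v)))
        + 1 / (x + 1) * min (f v) (f (Suc (Suc v)))"
      using f [unfolded biased_infinity_harmonic_iff, THEN conjunct2, THEN conjunct2,
          rule_format, of "Suc v"]
      by (simp only: diff_Suc_1) simp
    from biased_mean_step_sign [OF \<open>0 < x\<close> this] Suc show ?case
      by simp
  qed simp
  have "f 0 < f 1"
  proof (rule ccontr)
    assume "\<not> f 0 < f 1"
    then have decr: "f (Suc w) \<le> f w" if "w < n" for w
      using step [OF that] by simp
    have "f w \<le> f 0" if "w \<le> n" for w
      using that
    proof (induction w)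
      case (Suc w)
      then show ?case
        using decr [of w] by simp
    qed simp
    from this [of n] show False
      using f \<open>p 0 < p n\<close> by (simp add: biased_infinity_harmonic_iff)
  qed
  then show ?thesis
    using step \<open>v < n\<close> by blast
qed

lemma increasing_across:
  fixes f :: "nat \<Rightarrow> real"
  assumes incr: "\<And>w. w < n \<Longrightarrow> f w < f (Suc w)" and "0 < v" "v < n"
  shows "f (v - 1) < f (Suc v)"
proof -
  obtain w where w: "v = Suc w"
    using \<open>0 < v\<close> gr0_implies_Suc by blast
  then have "f w < f (Suc w)" "f (Suc w) < f (Suc (Suc w))"
    using \<open>v < n\<close> by (auto intro: incr)
  then show ?thesis
    using w by simp
qed

definition line_profile :: "nat \<Rightarrow> (nat \<Rightarrow> real) \<Rightarrow> real \<Rightarrow> nat \<Rightarrow> real" where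
  "line_profile n p x v = p n - (p n - p 0) * (geom (n - v) x / geom n x)"

lemma line_profile_step:
  assumes "v < n"
  shows "line_profile n p x (Suc v) - line_profile n p x v
    = (p n - p 0) * (x ^ (n - Suc v) / geom n x)"
proof -
  have "geom (n - v) x = geom (n - Suc v) x + x ^ (n - Suc v)"
    using geom_Suc [of "n - Suc v" x] assms by (simp add: Suc_diff_Suc)
  then show ?thesis
    by (simp add: line_profile_def add_divide_distrib algebra_simps)
qed

lemma line_profile_increasing:
  assumes "0 < x" "p 0 < p n" "v < n"
  shows "line_profile n p x v < line_profile n p x (Suc v)"
proof -
  have "0 < (p n - p 0) * (x ^ (n - Suc v) / geom n x)"
    using assms geom_pos [of x n] by auto
  then show ?thesis
    using line_profile_step [OF \<open>v < n\<close>, of p x] by linarith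
qed

lemma line_profile_biased_infinity_harmonic:
  assumes "0 < x" "p 0 < p n" "0 < n"
  shows "biased_infinity_harmonic n p x (line_profile n p x)"
  unfolding biased_infinity_harmonic_iff
proof (intro conjI allI impI)
  show "line_profile n p x 0 = p 0" "line_profile n p x n = p n"
    using geom_pos [of x n] assms by (simp_all add: line_profile_def)
next
  fix v assume v: "0 < v \<and> v < n"
  let ?h = "line_profile n p x"
  have "?h (v - 1) < ?h (Suc v)"
    using increasing_across [of n ?h v] line_profile_increasing [OF assms(1,2)] v by blast
  moreover have "?h v - ?h (v - 1) = x * (?h (Suc v) - ?h v)"
  proof -
    have "x ^ (n - v) = x * x ^ (n - Suc v)"
      using v by (metis Suc_diff_Suc power_Suc)
    moreover have "?h v - ?h (v - 1) = (p n - p 0) * (x ^ (n - v) / geom n x)"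
      using line_profile_step [of "v - 1" n p x] v by auto
    ultimately show ?thesis
      using line_profile_step [of v n p x] v by simp
  qed
  ultimately show "?h v = x / (x + 1) * max (?h (v - 1)) (?h (Suc v))
      + 1 / (x + 1) * min (?h (v - 1)) (?h (Suc v))"
    using biased_mean_increasing_iff [OF \<open>0 < x\<close>] by simp
qed

text \<open>Going left from the right end, every increment is \<open>x\<close> times its right neighbour, so the drop
  from \<open>p n\<close> over \<open>k\<close> steps is the last increment times \<open>S\<^sub>k\<close>.  The value at \<open>0\<close> fixes the last
  increment.\<close>

lemma increasing_solution_eq_profile:
  assumes "0 < x" and f: "biased_infinity_harmonic n p x f" and "p 0 < p n" and "v \<le> n"
  shows "f v = line_profile n p x v"
proof -
  have "0 < n"
    using \<open>p 0 < p n\<close> by (cases n) auto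
  define d where "d = f n - f (n - 1)"
  have incr: "f (n - k) - f (n - Suc k) = x ^ k * d" if "k < n" for k
    using that
  proof (induction k)
    case 0
    show ?case by (simp add: d_def)
  next
    case (Suc k)
    let ?v = "n - Suc k"
    have v: "0 < ?v" "?v < n" "Suc ?v = n - k" "?v - 1 = n - Suc (Suc k)"
      using Suc.prems by auto
    have "f (?v - 1) \<le> f (Suc ?v)"
      using increasing_across [of n f ?v] solution_strictly_increasing [OF assms(1-3)] v(1,2)
      by (simp only: less_imp_le)
    then have "f ?v - f (?v - 1) = x * (f (Suc ?v) - f ?v)"
      using f v(1,2) biased_mean_increasing_iff [OF \<open>0 < x\<close>]
      unfolding biased_infinity_harmonic_iff by blast
    then show ?case
      using Suc.IH Suc.prems unfolding v(3,4) by simp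
  qed
  have drop: "f n - f (n - k) = d * geom k x" if "k \<le> n" for k
    using that
  proof (induction k)
    case (Suc k)
    then show ?case
      using incr [of k] by (simp add: geom_Suc algebra_simps)
  qed simp
  have ends: "f 0 = p 0" "f n = p n"
    using f by (simp_all add: biased_infinity_harmonic_iff)
  have "d = (p n - p 0) / geom n x"
    using drop [of n] ends geom_pos [OF \<open>0 < x\<close> \<open>0 < n\<close>] by (simp add: field_simps)
  then show ?thesis
    using drop [of "n - v"] \<open>v \<le> n\<close> ends by (simp add: line_profile_def algebra_simps)
qed

lemma biased_infinity_harmonic_cong:
  assumes "\<And>v. v \<le> n \<Longrightarrow> f v = g v"
  shows "biased_infinity_harmonic n p x f \<longleftrightarrow> biased_infinity_harmonic n p x g"
proof -
  have "f ` line_nbrs n v = g ` line_nbrs n v" for v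
  proof (rule image_cong [OF refl])
    fix u assume "u \<in> line_nbrs n v"
    then show "f u = g u"
      by (intro assms) (simp add: line_nbrs_def line_adj_def)
  qed
  moreover have "f v = g v" if "v \<in> line_boundary n \<union> line_open n" for v
    using that by (intro assms) (auto simp: line_boundary_def line_open_def)
  ultimately show ?thesis
    by (simp add: biased_infinity_harmonic_def)
qed

lemma line_value_eq_profile:
  assumes "0 < x" "p 0 < p n" "v \<le> n"
  shows "line_value n p x v = line_profile n p x v"
proof -
  let ?h = "restrict (line_profile n p x) {0..n}"
  have "0 < n"
    using \<open>p 0 < p n\<close> by (cases n) auto
  then have "biased_infinity_harmonic n p x (line_profile n p x)"
    using line_profile_biased_infinity_harmonic assms by blast
  then have h: "biased_infinity_harmonic n p x ?h"
    using biased_infinity_harmonic_cong [of n ?h "line_profile n p x"] by simp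
  have "line_value n p x = ?h"
    unfolding line_value_def
  proof (rule the_equality)
    show "?h \<in> extensional {0..n} \<and> biased_infinity_harmonic n p x ?h"
      using h by simp
    fix f assume f: "f \<in> extensional {0..n} \<and> biased_infinity_harmonic n p x f"
    then have "f v = ?h v" if "v \<in> {0..n}" for v
      using increasing_solution_eq_profile [OF \<open>0 < x\<close> _ \<open>p 0 < p n\<close>, of f v] that by simp
    with f show "f = ?h"
      by (metis extensionalityI restrict_extensional)
  qed
  then show ?thesis
    using \<open>v \<le> n\<close> by simp
qed

section \<open>The stake\<close>

lemma line_Delta_eq:
  assumes "0 < x" "p 0 < p n" "0 < i" "i < n"
  shows "line_Delta n p x i = (p n - p 0) * (x ^ (n - i - 1) * (x + 1) / geom n x)"
proof -
  let ?h = "line_profile n p x"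
  have h: "line_value n p x (i - 1) = ?h (i - 1)" "line_value n p x (Suc i) = ?h (Suc i)"
    using line_value_eq_profile [OF assms(1,2)] assms by auto
  have le: "?h (i - 1) \<le> ?h (Suc i)"
    using increasing_across [of n ?h i] line_profile_increasing [OF assms(1,2)] assms(3,4)
    by (simp only: less_imp_le)
  have pow: "x ^ (n - i) = x * x ^ (n - i - 1)"
    using assms by (metis Suc_diff_Suc Suc_eq_plus1 diff_diff_left power_Suc)
  have "line_Delta n p x i = ?h (Suc i) - ?h (i - 1)"
    using assms le by (simp add: line_Delta_def Max_line_nbrs Min_line_nbrs h [simplified])
  also have "\<dots> = (?h (Suc i) - ?h i) + (?h (Suc (i - 1)) - ?h (i - 1))"
    using assms by simp
  also have "\<dots> = (p n - p 0) * (x ^ (n - i - 1) / geom n x)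
      + (p n - p 0) * (x ^ (n - i) / geom n x)"
    using assms line_profile_step [of i n p x] line_profile_step [of "i - 1" n p x] by simp
  finally show ?thesis
    unfolding pow by (simp add: add_divide_distrib algebra_simps)
qed

lemma deriv_line_value:
  assumes "0 < x" "p 0 < p n" "i \<le> n"
  shows "deriv (\<lambda>l. line_value n p l i) x = (p n - p 0)
    * ((geom (n - i) x * geom_deriv n x - geom_deriv (n - i) x * geom n x) / (geom n x)\<^sup>2)"
proof (rule DERIV_imp_deriv)
  have "0 < n"
    using \<open>p 0 < p n\<close> by (cases n) auto
  then have "geom n x \<noteq> 0"
    using geom_pos [of x n] \<open>0 < x\<close> by simp
  then have "((\<lambda>l. line_profile n p l i) has_field_derivative 0 - (p n - p 0)
      * ((geom_deriv (n - i) x * geom n x - geom (n - i) x * geom_deriv n x)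
        / (geom n x * geom n x))) (at x)"
    unfolding line_profile_def
    by (intro DERIV_diff DERIV_const DERIV_cmult DERIV_divide geom_has_field_derivative)
  moreover have "0 - q * ((a - b) / (c * c)) = q * ((b - a) / c\<^sup>2)" for q a b c :: real
    by (simp add: power2_eq_square diff_divide_distrib algebra_simps)
  ultimately have "((\<lambda>l. line_profile n p l i) has_field_derivative (p n - p 0)
      * ((geom (n - i) x * geom_deriv n x - geom_deriv (n - i) x * geom n x) / (geom n x)\<^sup>2)) (at x)"
    by simp
  \<comment> \<open>The explicit value holds for all positive biases, hence on a neighbourhood of \<open>x\<close>.\<close>
  then show "((\<lambda>l. line_value n p l i) has_field_derivative (p n - p 0)
      * ((geom (n - i) x * geom_deriv n x - geom_deriv (n - i) x * geom n x) / (geom n x)\<^sup>2)) (at x)"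
    by (rule has_field_derivative_transform_within_open [of _ _ _ "{0<..}"])
      (use assms line_value_eq_profile in auto)
qed

text \<open>The payment difference cancels here, which is why the stake is the same for all payments.
  The Wronskian comes from the quotient rule for \<open>S\<^bsub>n-i\<^esub> / S\<^sub>n\<close>.\<close>

lemma Stake_eq_wronskian:
  assumes "0 < x" "p 0 < p n" "0 < i" "i < n"
  shows "Stake n p eps x i = eps * (x ^ (n - i - 1) * geom n x / ((x + 1)
    * (geom (n - i) x * geom_deriv n x - geom_deriv (n - i) x * geom n x)))"
proof -
  have cancel: "eps * (q * (y * t / g)) / (t\<^sup>2 * (q * (w / g\<^sup>2))) = eps * (y * g / (t * w))"
    if "q \<noteq> 0" "t \<noteq> 0" "g \<noteq> 0" for q y t g w :: real
    using that by (cases "w = 0") (simp_all add: field_simps power2_eq_square)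
  show ?thesis
    unfolding Stake_def line_Delta_eq [OF assms]
      deriv_line_value [OF assms(1,2) less_imp_le [OF \<open>i < n\<close>]]
    using assms geom_pos [of x n] by (intro cancel) auto
qed

lemma mult_one_minus_divide:
  fixes k m a b :: real
  assumes "k \<noteq> 0"
  shows "k * (1 - m * a / (k * b)) = k - m * (a / b)"
proof -
  have "k * (m * a / (k * b)) = m * (a / b)"
    using assms by simp
  then show ?thesis
    by (simp only: right_diff_distrib mult_1_right)
qed

lemma Stake_eq_closed_form:
  assumes "0 < x" "x \<noteq> 1" "p 0 < p n" "0 < i" "i < n"
  shows "Stake n p eps x i = eps * inverse ((x + 1) / (x - 1) * real i
    * (1 - real n * (x ^ i - 1) / (real i * (x ^ n - 1))))"
proof -
  define W where "W = geom (n - i) x * geom_deriv n x - geom_deriv (n - i) x * geom n x"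
  define R where "R = real i * geom n x - real n * geom i x"
  have g: "0 < geom n x"
    using geom_pos assms by simp
  have W: "W = x ^ (n - i - 1) * R / (x - 1)"
    using geom_wronskian [OF \<open>0 < i\<close> \<open>i < n\<close>, of x] \<open>x \<noteq> 1\<close>
    unfolding W_def [symmetric] R_def [symmetric] by (simp add: field_simps)
  have quot: "(x ^ i - 1) / (x ^ n - 1) = geom i x / geom n x"
    using \<open>x \<noteq> 1\<close> by (simp flip: geom_mult_diff)
  have "real i * (1 - real n * (x ^ i - 1) / (real i * (x ^ n - 1)))
      = real i - real n * ((x ^ i - 1) / (x ^ n - 1))"
    using \<open>0 < i\<close> by (intro mult_one_minus_divide) simp
  also have "\<dots> = R / geom n x"
    unfolding quot R_def using g by (simp add: field_simps)
  finally have "inverse ((x + 1) / (x - 1) * real i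
      * (1 - real n * (x ^ i - 1) / (real i * (x ^ n - 1))))
      = inverse ((x + 1) / (x - 1) * (R / geom n x))"
    by (simp add: mult.assoc)
  also have "\<dots> = x ^ (n - i - 1) * geom n x / ((x + 1) * W)"
  proof -
    have "inverse (t / d * (R / g)) = y * g / (t * (y * R / d))" if "y \<noteq> 0" for t d g y :: real
      using that by (simp add: divide_inverse mult_ac)
    then show ?thesis
      unfolding W using \<open>0 < x\<close> by simp
  qed
  finally show ?thesis
    using Stake_eq_wronskian [OF assms(1,3-5)] by (simp add: W_def)
qed

text \<open>Under \<open>x \<mapsto> 1/x\<close>, \<open>i \<mapsto> n - i\<close> both \<open>(x + 1) / (x - 1)\<close> and
  \<open>i - n (x\<^sup>i - 1) / (x\<^sup>n - 1)\<close> change sign.\<close>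

lemma Stake_inverse:
  assumes "0 < x" "x \<noteq> 1" "p 0 < p n" "0 < i" "i < n"
  shows "Stake n p eps x i = Stake n p eps (inverse x) (n - i)"
proof -
  have xn: "x ^ n \<noteq> 1"
    using geom_mult_diff [of x n] geom_pos [of x n] assms by force
  have split: "x ^ n = x ^ i * x ^ (n - i)"
    using assms by (simp flip: power_add)
  have num: "inverse x ^ (n - i) - 1 = (x ^ i - x ^ n) / x ^ n"
    using assms unfolding split by (simp add: field_simps)
  have den: "inverse x ^ n - 1 = (1 - x ^ n) / x ^ n"
    using assms by (simp add: field_simps)
  have "(inverse x ^ (n - i) - 1) / (inverse x ^ n - 1) = (x ^ i - x ^ n) / (1 - x ^ n)"
    unfolding num den using assms by simp
  also have "\<dots> = 1 - (x ^ i - 1) / (x ^ n - 1)"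
    using xn by (simp add: field_simps)
  finally have quot: "(inverse x ^ (n - i) - 1) / (inverse x ^ n - 1)
      = 1 - (x ^ i - 1) / (x ^ n - 1)" .
  have bias: "(inverse x + 1) / (inverse x - 1) = - ((x + 1) / (x - 1))"
    using assms by (simp add: field_simps)
  have "(inverse x + 1) / (inverse x - 1) * real (n - i)
        * (1 - real n * (inverse x ^ (n - i) - 1) / (real (n - i) * (inverse x ^ n - 1)))
      = - ((x + 1) / (x - 1)) * (real (n - i) - real n * (1 - (x ^ i - 1) / (x ^ n - 1)))"
    using assms by (simp only: mult.assoc bias quot [symmetric]) (subst mult_one_minus_divide, simp_all)
  also have "\<dots> = (x + 1) / (x - 1) * (real i - real n * ((x ^ i - 1) / (x ^ n - 1)))"
  proof -
    have "- a * (real n - real i - real n * (1 - b)) = a * (real i - real n * b)" for a b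
      by (simp add: algebra_simps)
    then show ?thesis
      using \<open>i < n\<close> by (simp only: of_nat_diff less_imp_le)
  qed
  also have "\<dots> = (x + 1) / (x - 1) * real i
        * (1 - real n * (x ^ i - 1) / (real i * (x ^ n - 1)))"
    unfolding mult.assoc using assms by (subst mult_one_minus_divide) simp_all
  finally show ?thesis
    using Stake_eq_closed_form [OF assms]
      Stake_eq_closed_form [of "inverse x" p n "n - i"] assms by simp
qed

text \<open>At \<open>\<lambda> = 1\<close>, \<open>S\<^sub>k\<close> is \<open>k\<close> and its derivative is \<open>k (k - 1) / 2\<close>, so the Wronskian is
  \<open>i (n - i) n / 2\<close>.\<close>

lemma Stake_unbiased:
  assumes "p 0 < p n" "0 < i" "i < n"
  shows "Stake n p eps 1 i = eps * (1 / (real i * real (n - i)))"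
proof -
  define m where "m = n - i"
  have n: "real n = real i + real m"
    using assms by (simp add: m_def)
  have "geom m 1 * geom_deriv n 1 - geom_deriv m 1 * geom n 1 = real i * real m * real n / 2"
    unfolding geom_deriv_at_1 geom_at_1 n by (simp add: field_simps)
  then have "Stake n p eps 1 i = eps * (real n / (2 * (real i * real m * real n / 2)))"
    unfolding Stake_eq_wronskian [of 1 p n i eps, OF zero_less_one assms]
    by (simp only: m_def geom_at_1 power_one mult_1_left one_add_one)
  also have "real n / (2 * (real i * real m * real n / 2)) = 1 / (real i * real m)"
    using assms by simp
  finally show ?thesis
    by (simp only: m_def)
qed

text \<open>The first three claims are the instance \<open>p = indicator {n}\<close> of the fourth.\<close>

theorem proposition1p18:
  fixes n i :: nat and eps :: real
  assumes "n \<ge> 1" and "i \<in> {1..n - 1}" and "eps \<in> {0<..1}"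
  shows
    "(\<forall>lam \<in> {0<..} - {1}. Stake n (indicator {n}) eps lam i =
        eps * inverse ((lam + 1) / (lam - 1) * real i *
          (1 - real n * (lam ^ i - 1) / (real i * (lam ^ n - 1))))) \<and>
     (\<forall>lam \<in> {0<..} - {1}. Stake n (indicator {n}) eps lam i =
        Stake n (indicator {n}) eps (inverse lam) (n - i)) \<and>
     Stake n (indicator {n}) eps 1 i = eps * (1 / (real i * real (n - i))) \<and>
     (\<forall>p :: nat \<Rightarrow> real. (\<forall>v \<in> line_boundary n. 0 \<le> p v) \<and> p 0 < p n \<longrightarrow>
        (\<forall>lam \<in> {0<..} - {1}. Stake n p eps lam i =
           eps * inverse ((lam + 1) / (lam - 1) * real i *
             (1 - real n * (lam ^ i - 1) / (real i * (lam ^ n - 1))))) \<and>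
        (\<forall>lam \<in> {0<..} - {1}. Stake n p eps lam i =
           Stake n p eps (inverse lam) (n - i)) \<and>
        Stake n p eps 1 i = eps * (1 / (real i * real (n - i))))"
proof -
  have i: "0 < i" "i < n"
    using assms(2) by auto
  have closed_form: "Stake n p eps lam i = eps * inverse ((lam + 1) / (lam - 1) * real i
      * (1 - real n * (lam ^ i - 1) / (real i * (lam ^ n - 1))))"
    if "p 0 < p n" "lam \<in> {0<..} - {1}" for p lam
    by (rule Stake_eq_closed_form) (use that i in simp_all)
  have symmetry: "Stake n p eps lam i = Stake n p eps (inverse lam) (n - i)"
    if "p 0 < p n" "lam \<in> {0<..} - {1}" for p lam
    by (rule Stake_inverse) (use that i in simp_all)
  have indicator: "(indicator {n} 0 :: real) < indicator {n} n"
    using i by simp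
  show ?thesis
    using closed_form symmetry Stake_unbiased [OF _ i] indicator by blast
qed

end
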